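(* Let $\gamma:I\to\mathbb{R}^3$ be a non-degenerate curve with curvature $\kappa$ and torsion $\tau$. Suppose that $\tau(t)\neq0$ for all $t\in I$. (1) Suppose that there exists a smooth map $(\lambda^I,\eta^I):I\to\mathbb{R}^2$ with $\eta^I(t)\neq0$ such that $$|\dot\gamma(t)|+\dot\lambda^I(t)-\eta^I(t)|\dot\gamma(t)|\kappa(t)=0,\qquad \lambda^I(t)|\dot\gamma(t)|\kappa(t)+\dot\eta^I(t)=0$$ for all $t\in I$, and let $\mathrm{Inv}(\gamma)$ be the involute of $\gamma$ determined by $(\lambda^I,\eta^I)$. Then the evolute of the involute $\mathrm{Ev}(\mathrm{Inv}(\gamma))$ exists. Moreover, $\mathrm{Ev}(\mathrm{Inv}(\gamma))=\gamma$. (2) Let $\lambda^E=1/\kappa$ and $\eta^E=-\dot\kappa/(|\dot\gamma|\kappa^2\tau)$, and suppose that $$h(t):=\frac{|\dot\gamma(t)|\tau(t)}{\kappa(t)}-\frac{d}{dt}\left(\frac{\dot\kappa(t)}{\kappa^2(t)}\,\frac{1}{|\dot\gamma(t)|\tau(t)}\right)\neq0$$ for all $t\in I$. (i) Suppose that $\tau>0$ and $h>0$ on $I$. If we take $\lambda^I=-\eta^E$ and $\eta^I=\lambda^E$, then the involute of the evolute $\mathrm{Inv}(\mathrm{Ev}(\gamma))$ (determined by $(\lambda^I,\eta^I)$) exists. Moreover, $\mathrm{Inv}(\mathrm{Ev}(\gamma))=\gamma$. (ii) Suppose that $\tau>0$ and $h<0$ on $I$. If we take $\lambda^I=\eta^E$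 and $\eta^I=-\lambda^E$, then $\mathrm{Inv}(\mathrm{Ev}(\gamma))$ exists. Moreover, $\mathrm{Inv}(\mathrm{Ev}(\gamma))=\gamma$. (iii) Suppose that $\tau<0$ and $h>0$ on $I$. If we take $\lambda^I=-\eta^E$ and $\eta^I=-\lambda^E$, then $\mathrm{Inv}(\mathrm{Ev}(\gamma))$ exists. Moreover, $\mathrm{Inv}(\mathrm{Ev}(\gamma))=\gamma$. (iv) Suppose that $\tau<0$ and $h<0$ on $I$. If we take $\lambda^I=\eta^E$ and $\eta^I=\lambda^E$, then $\mathrm{Inv}(\mathrm{Ev}(\gamma))$ exists. Moreover, $\mathrm{Inv}(\mathrm{Ev}(\gamma))=\gamma$.
   Context: All maps are $C^\infty$; $I\subset\mathbb{R}$ is an interval. A smooth curve $\gamma:I\to\mathbb{R}^3$ is non-degenerate if it is regular ($\dot\gamma(t)\neq0$ for all $t$) and $\dot\gamma(t)\times\ddot\gamma(t)\neq 0$ for all $t\in I$. For such a curve, the tangent, bi-normal and principal normal vectors are $t=\dot\gamma/|\dot\gamma|$, $b=(\dot\gamma\times\ddot\gamma)/|\dot\gamma\times\ddot\gamma|$, $n=b\times t$, the curvature is $\kappa=|\dot\gamma\times\ddot\gamma|/|\dot\gamma|^3$ and the torsion is $\tau=\det(\dot\gamma,\ddot\gamma,\dddot\gamma)/|\dot\gamma\times\ddot\gamma|^2$ (the letter $t$ also denotes the parameter). Evolute: for a non-degenerate curve $\gamma$ with nowhere vanishing torsion, the evolute is $\mathrm{Ev}(\gamma)(t)=\gamma(t)+\frac{1}{\kappa(t)}n(t)-\frac{\dot\kappa(t)}{|\dot\gamma(t)|\kappa^2(t)\tau(t)}b(t)$.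 Involute: for a non-degenerate curve $\gamma$ with nowhere vanishing torsion and a smooth map $(\lambda^I,\eta^I):I\to\mathbb{R}^2$ with $\eta^I(t)\neq0$ satisfying $|\dot\gamma|+\dot\lambda^I-\eta^I|\dot\gamma|\kappa=0$ and $\lambda^I|\dot\gamma|\kappa+\dot\eta^I=0$ on $I$, the involute of $\gamma$ determined by $(\lambda^I,\eta^I)$ is $\mathrm{Inv}(\gamma)(t)=\gamma(t)+\lambda^I(t)t(t)+\eta^I(t)n(t)$. "$\mathrm{Ev}(\mathrm{Inv}(\gamma))$ exists" means that $\mathrm{Inv}(\gamma)$ satisfies the requirements in the definition of the evolute (it is non-degenerate with nowhere vanishing torsion). "$\mathrm{Inv}(\mathrm{Ev}(\gamma))$ exists" means that $\mathrm{Ev}(\gamma)$ and $(\lambda^I,\eta^I)$ satisfy the requirements in the definition of the involute, i.e. $\mathrm{Ev}(\gamma)$ is non-degenerate with nowhere vanishing torsion, $\eta^I\ne0$ everywhere, and the two displayed equations hold with $\gamma,\kappa$ replaced by $\mathrm{Ev}(\gamma)$ and its curvature; the frame used in $\mathrm{Inv}(\mathrm{Ev}(\gamma))$ is the Frenet frame of $\mathrm{Ev}(\gamma)$. *)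

theory Defs
  imports "HOL-Analysis.Analysis"
begin

text \<open>
  Derivatives are taken within the parameter interval, so they are one-sided at an end point
  that belongs to it; only the values of a map on the interval matter. They are meaningful
  only if the interval has more than one point.
\<close>

definition deriv_on :: "real set \<Rightarrow> (real \<Rightarrow> 'a::real_normed_vector) \<Rightarrow> real \<Rightarrow> 'a" where
  "deriv_on I f t = vector_derivative f (at t within I)"

text \<open>
  \<open>C\<^sup>\<infinity>\<close>: every iterated derivative is differentiable on the interval (hence also continuous).
\<close>

definition smooth_on :: "real set \<Rightarrow> (real \<Rightarrow> 'a::real_normed_vector) \<Rightarrow> bool" where
  "smooth_on I f \<longleftrightarrow> (\<forall>k. (deriv_on I ^^ k) f differentiable_on I)"

definition speed :: "real set \<Rightarrow> (real \<Rightarrow> real^3) \<Rightarrow> real \<Rightarrow> real" where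
  "speed I \<gamma> t = norm (deriv_on I \<gamma> t)"

definition velocity_cross_accel :: "real set \<Rightarrow> (real \<Rightarrow> real^3) \<Rightarrow> real \<Rightarrow> real^3" where
  "velocity_cross_accel I \<gamma> t =
     cross3 (deriv_on I \<gamma> t) (deriv_on I (deriv_on I \<gamma>) t)"

definition nondegenerate :: "real set \<Rightarrow> (real \<Rightarrow> real^3) \<Rightarrow> bool" where
  "nondegenerate I \<gamma> \<longleftrightarrow>
     smooth_on I \<gamma> \<and>
     (\<forall>t\<in>I. deriv_on I \<gamma> t \<noteq> 0) \<and>
     (\<forall>t\<in>I. velocity_cross_accel I \<gamma> t \<noteq> 0)"

definition unit_tangent :: "real set \<Rightarrow> (real \<Rightarrow> real^3) \<Rightarrow> real \<Rightarrow> real^3" where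
  "unit_tangent I \<gamma> t = deriv_on I \<gamma> t /\<^sub>R speed I \<gamma> t"

definition binormal :: "real set \<Rightarrow> (real \<Rightarrow> real^3) \<Rightarrow> real \<Rightarrow> real^3" where
  "binormal I \<gamma> t = velocity_cross_accel I \<gamma> t /\<^sub>R norm (velocity_cross_accel I \<gamma> t)"

definition principal_normal :: "real set \<Rightarrow> (real \<Rightarrow> real^3) \<Rightarrow> real \<Rightarrow> real^3" where
  "principal_normal I \<gamma> t = cross3 (binormal I \<gamma> t) (unit_tangent I \<gamma> t)"

definition curvature :: "real set \<Rightarrow> (real \<Rightarrow> real^3) \<Rightarrow> real \<Rightarrow> real" where
  "curvature I \<gamma> t = norm (velocity_cross_accel I \<gamma> t) / speed I \<gamma> t ^ 3"

definition torsion :: "real set \<Rightarrow> (real \<Rightarrow> real^3) \<Rightarrow> real \<Rightarrow> real" where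
  "torsion I \<gamma> t =
     det (vector [deriv_on I \<gamma> t,
                  deriv_on I (deriv_on I \<gamma>) t,
                  deriv_on I (deriv_on I (deriv_on I \<gamma>)) t] :: real^3^3)
       / norm (velocity_cross_accel I \<gamma> t) ^ 2"

text \<open>
  The evolute and the involute are total functions; they are only meaningful under the
  requirements on the curve (and on the pair of functions) stated by the predicates
  \<open>evolute_exists\<close> and \<open>involute_exists\<close>.
\<close>

definition evolute_exists :: "real set \<Rightarrow> (real \<Rightarrow> real^3) \<Rightarrow> bool" where
  "evolute_exists I \<gamma> \<longleftrightarrow> nondegenerate I \<gamma> \<and> (\<forall>t\<in>I. torsion I \<gamma> t \<noteq> 0)"

definition evolute :: "real set \<Rightarrow> (real \<Rightarrow> real^3) \<Rightarrow> real \<Rightarrow> real^3" where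
  "evolute I \<gamma> t =
     \<gamma> t + (1 / curvature I \<gamma> t) *\<^sub>R principal_normal I \<gamma> t
         - (deriv_on I (curvature I \<gamma>) t
             / (speed I \<gamma> t * curvature I \<gamma> t ^ 2 * torsion I \<gamma> t)) *\<^sub>R binormal I \<gamma> t"

definition involute_pair ::
    "real set \<Rightarrow> (real \<Rightarrow> real^3) \<Rightarrow> (real \<Rightarrow> real) \<Rightarrow> (real \<Rightarrow> real) \<Rightarrow> bool" where
  "involute_pair I \<gamma> lam eta \<longleftrightarrow>
     smooth_on I (\<lambda>t. (lam t, eta t)) \<and>
     (\<forall>t\<in>I. eta t \<noteq> 0) \<and>
     (\<forall>t\<in>I. speed I \<gamma> t + deriv_on I lam t - eta t * speed I \<gamma> t * curvature I \<gamma> t = 0) \<and>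
     (\<forall>t\<in>I. lam t * speed I \<gamma> t * curvature I \<gamma> t + deriv_on I eta t = 0)"

definition involute_exists ::
    "real set \<Rightarrow> (real \<Rightarrow> real^3) \<Rightarrow> (real \<Rightarrow> real) \<Rightarrow> (real \<Rightarrow> real) \<Rightarrow> bool" where
  "involute_exists I \<gamma> lam eta \<longleftrightarrow>
     nondegenerate I \<gamma> \<and> (\<forall>t\<in>I. torsion I \<gamma> t \<noteq> 0) \<and> involute_pair I \<gamma> lam eta"

definition involute ::
    "real set \<Rightarrow> (real \<Rightarrow> real^3) \<Rightarrow> (real \<Rightarrow> real) \<Rightarrow> (real \<Rightarrow> real) \<Rightarrow> real \<Rightarrow> real^3" where
  "involute I \<gamma> lam eta t =
     \<gamma> t + lam t *\<^sub>R unit_tangent I \<gamma> t + eta t *\<^sub>R principal_normal I \<gamma> t"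

definition lambda_E :: "real set \<Rightarrow> (real \<Rightarrow> real^3) \<Rightarrow> real \<Rightarrow> real" where
  "lambda_E I \<gamma> t = 1 / curvature I \<gamma> t"

definition eta_E :: "real set \<Rightarrow> (real \<Rightarrow> real^3) \<Rightarrow> real \<Rightarrow> real" where
  "eta_E I \<gamma> t =
     - deriv_on I (curvature I \<gamma>) t / (speed I \<gamma> t * curvature I \<gamma> t ^ 2 * torsion I \<gamma> t)"

definition evolute_h :: "real set \<Rightarrow> (real \<Rightarrow> real^3) \<Rightarrow> real \<Rightarrow> real" where
  "evolute_h I \<gamma> t =
     speed I \<gamma> t * torsion I \<gamma> t / curvature I \<gamma> t
     - deriv_on I (\<lambda>s. deriv_on I (curvature I \<gamma>) s / curvature I \<gamma> s ^ 2
                         * (1 / (speed I \<gamma> s * torsion I \<gamma> s))) t"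

end

theory Submission imports Defs begin

text \<open>
  Let \<open>T\<close>, \<open>N\<close>, \<open>B\<close> be the Frenet frame of \<open>\<gamma>\<close>, and let \<open>p\<close> and \<open>q\<close> be the products of its speed with
  its curvature and torsion, so that \<open>T' = p N\<close>, \<open>N' = - p T + q B\<close> and \<open>B' = - q N\<close>.

  Both constructions lead to a curve \<open>\<sigma>\<close> that moves along the binormal of \<open>\<gamma>\<close>, that is,
  \<open>\<sigma>' = u B\<close>.  For an involute, \<open>u = eta q\<close>, because the two equations for \<open>lam\<close> and \<open>eta\<close> cancel the
  other components (\<open>involute_derivative\<close>).  For the evolute, \<open>u = h\<close>, because its coefficients
  \<open>1 / \<kappa>\<close> and \<open>eta_E\<close> are related by \<open>(1 / \<kappa>)' = eta_E q\<close> (\<open>evolute_derivative\<close>).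

  For every such curve with \<open>u \<noteq> 0\<close>, the Frenet formulas give \<open>\<sigma>' \<times> \<sigma>'' = u\<^sup>2 q T\<close>.  So \<open>\<sigma>\<close> is
  non-degenerate, its speed is \<open>|u|\<close>, its curvature is \<open>|q| / |u|\<close>, its torsion is \<open>p / u\<close>, which is
  never zero, and its frame consists of \<open>sgn u B\<close>, \<open>- sgn u sgn q N\<close> and \<open>sgn q T\<close>.  Substituting
  these values into the definitions of evolute and involute, the added terms cancel those that
  led from \<open>\<gamma>\<close> to \<open>\<sigma>\<close> (\<open>evolute_involute\<close> and \<open>involute_evolute\<close>).  The four sign cases for the evolute
  reflect the signs in its frame.

  A smooth map has to be differentiated up to an end point of the interval, within the interval.
  The required calculus is obtained by induction on the order of differentiability.
\<close>

unbundle cross3_syntax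

section \<open>Calculus of smooth maps on an interval\<close>

text \<open>
  A finite-order version of smoothness, made for induction on the order. Asking only for
  some function \<open>g\<close> that is a derivative on \<open>I\<close>, instead of for the derivative chosen by
  \<^const>\<open>deriv_on\<close>, keeps the calculus rules below independent of the shape of \<open>I\<close> and of
  the values that functions take outside \<open>I\<close>.
\<close>
primrec times_differentiable :: "real set \<Rightarrow> nat \<Rightarrow> (real \<Rightarrow> 'a::real_normed_vector) \<Rightarrow> bool" where
  "times_differentiable I 0 f \<longleftrightarrow> True"
| "times_differentiable I (Suc k) f \<longleftrightarrow>
     (\<exists>g. (\<forall>t\<in>I. (f has_vector_derivative g t) (at t within I)) \<and> times_differentiable I k g)"

lemma times_differentiable_cong:
  assumes "\<And>t. t \<in> I \<Longrightarrow> f t = g t" and "times_differentiable I k f"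
  shows "times_differentiable I k g"
proof (cases k)
  case (Suc j)
  with assms(2) obtain d where d: "\<forall>t\<in>I. (f has_vector_derivative d t) (at t within I)"
    "times_differentiable I j d" by auto
  have "(g has_vector_derivative d t) (at t within I)" if "t \<in> I" for t
    by (rule has_vector_derivative_transform[of t I g f]) (use that assms(1) d in auto)
  with d Suc show ?thesis by auto
qed simp

lemma times_differentiable_mono:
  "times_differentiable I (Suc k) f \<Longrightarrow> times_differentiable I k f"
  by (induction k arbitrary: f) auto

lemma times_differentiable_add:
  "times_differentiable I k f \<Longrightarrow> times_differentiable I k g \<Longrightarrow>
    times_differentiable I k (\<lambda>t. f t + g t)"
proof (induction k arbitrary: f g)
  case (Suc k)
  then obtain f' g' where "\<forall>t\<in>I. (f has_vector_derivative f' t) (at t within I)"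
    "\<forall>t\<in>I. (g has_vector_derivative g' t) (at t within I)"
    "times_differentiable I k f'" "times_differentiable I k g'" by auto
  then show ?case
    by (auto intro!: exI[of _ "\<lambda>t. f' t + g' t"] Suc.IH has_vector_derivative_add)
qed simp

lemma times_differentiable_linear:
  assumes "bounded_linear L"
  shows "times_differentiable I k f \<Longrightarrow> times_differentiable I k (\<lambda>t. L (f t))"
proof (induction k arbitrary: f)
  case (Suc k)
  then obtain f' where "\<forall>t\<in>I. (f has_vector_derivative f' t) (at t within I)"
    "times_differentiable I k f'" by auto
  then show ?case
    by (auto intro!: exI[of _ "\<lambda>t. L (f' t)"] Suc.IH bounded_linear.has_vector_derivative[OF assms])
qed simp

text \<open>
  One product rule serves scalar multiples, inner products and cross products. The derivative
  \<open>pr f g' + pr f' g\<close> contains the undifferentiated factors, so the induction also needs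
  them at the lower order.
\<close>
lemma times_differentiable_bilinear:
  assumes "bounded_bilinear pr"
  shows "times_differentiable I k f \<Longrightarrow> times_differentiable I k g \<Longrightarrow>
    times_differentiable I k (\<lambda>t. pr (f t) (g t))"
proof (induction k arbitrary: f g)
  case (Suc k)
  then obtain f' g' where "\<forall>t\<in>I. (f has_vector_derivative f' t) (at t within I)"
    "\<forall>t\<in>I. (g has_vector_derivative g' t) (at t within I)"
    "times_differentiable I k f'" "times_differentiable I k g'" by auto
  moreover have "times_differentiable I k f" "times_differentiable I k g"
    using Suc.prems by (blast intro: times_differentiable_mono)+
  ultimately show ?case
    by (auto intro!: exI[of _ "\<lambda>t. pr (f t) (g' t) + pr (f' t) (g t)"] Suc.IH
        times_differentiable_add bounded_bilinear.has_vector_derivative[OF assms])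
qed simp

lemma has_vector_derivative_inverse:
  fixes f :: "real \<Rightarrow> real"
  assumes "(f has_vector_derivative d) (at t within S)" "f t \<noteq> 0"
  shows "((\<lambda>t. inverse (f t)) has_vector_derivative - (d * (inverse (f t) * inverse (f t)))) (at t within S)"
  using DERIV_inverse_fun[of f d t S] assms
  by (simp add: has_real_derivative_iff_has_vector_derivative[symmetric] power2_eq_square)

lemma has_vector_derivative_norm:
  fixes f :: "real \<Rightarrow> 'a::real_inner"
  assumes "(f has_vector_derivative d) (at t within S)" "f t \<noteq> 0"
  shows "((\<lambda>t. norm (f t)) has_vector_derivative (d \<bullet> f t) * inverse (norm (f t))) (at t within S)"
proof -
  have "((norm \<circ> f) has_derivative ((\<lambda>h. h \<bullet> sgn (f t)) \<circ> (\<lambda>x. x *\<^sub>R d))) (at t within S)"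
    by (rule diff_chain_within)
      (use assms has_derivative_norm in \<open>auto simp: has_vector_derivative_def intro: has_derivative_at_withinI\<close>)
  then show ?thesis
    unfolding has_vector_derivative_def comp_def
    by (rule has_derivative_eq_rhs) (simp add: sgn_div_norm fun_eq_iff mult_ac)
qed

text \<open>
  The derivative of \<open>1 / f\<close> is a product of \<open>f'\<close> and of \<open>1 / f\<close> itself, which is covered by the
  induction hypothesis; no explicit formula for higher derivatives is needed.  The same
  bootstrapping works for \<open>norm f\<close>, whose derivative is \<open>(f' \<bullet> f) / norm f\<close>.
\<close>
lemma times_differentiable_inverse:
  fixes f :: "real \<Rightarrow> real"
  assumes "\<And>t. t \<in> I \<Longrightarrow> f t \<noteq> 0"
  shows "times_differentiable I k f \<Longrightarrow> times_differentiable I k (\<lambda>t. inverse (f t))"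
proof (induction k)
  case (Suc k)
  then obtain f' where f': "\<forall>t\<in>I. (f has_vector_derivative f' t) (at t within I)"
    "times_differentiable I k f'" by auto
  have inv: "times_differentiable I k (\<lambda>t. inverse (f t))"
    using Suc by (blast intro: times_differentiable_mono)
  have "times_differentiable I k (\<lambda>t. - (f' t * (inverse (f t) * inverse (f t))))"
    by (rule times_differentiable_linear[OF bounded_linear_minus[OF bounded_linear_ident]]
        times_differentiable_bilinear[OF bounded_bilinear_mult] f' inv)+
  with f' assms show ?case by (auto intro!: exI has_vector_derivative_inverse)
qed simp

lemma times_differentiable_norm:
  fixes f :: "real \<Rightarrow> 'a::real_inner"
  assumes nz: "\<And>t. t \<in> I \<Longrightarrow> f t \<noteq> 0"
  shows "times_differentiable I k f \<Longrightarrow> times_differentiable I k (\<lambda>t. norm (f t))"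
proof (induction k)
  case (Suc k)
  then obtain f' where f': "\<forall>t\<in>I. (f has_vector_derivative f' t) (at t within I)"
    "times_differentiable I k f'" by auto
  have f: "times_differentiable I k f"
    using Suc.prems by (blast intro: times_differentiable_mono)
  have "times_differentiable I k (\<lambda>t. inverse (norm (f t)))"
    by (rule times_differentiable_inverse) (use nz Suc.IH[OF f] in auto)
  then have "times_differentiable I k (\<lambda>t. (f' t \<bullet> f t) * inverse (norm (f t)))"
    by (intro times_differentiable_bilinear[OF bounded_bilinear_mult]
        times_differentiable_bilinear[OF bounded_bilinear_inner] f' f)
  with f' nz show ?case by (auto intro!: exI has_vector_derivative_norm)
qed simp

lemma times_differentiable_Pair:
  "times_differentiable I k f \<Longrightarrow> times_differentiable I k g \<Longrightarrow>
    times_differentiable I k (\<lambda>t. (f t, g t))"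
proof (induction k arbitrary: f g)
  case (Suc k)
  then obtain f' g' where "\<forall>t\<in>I. (f has_vector_derivative f' t) (at t within I)"
    "\<forall>t\<in>I. (g has_vector_derivative g' t) (at t within I)"
    "times_differentiable I k f'" "times_differentiable I k g'" by auto
  then show ?case
    by (auto intro!: exI[of _ "\<lambda>t. (f' t, g' t)"] Suc.IH has_vector_derivative_Pair)
qed simp

lemma bounded_bilinear_cross3: "bounded_bilinear cross3"
  using bilinear_cross bilinear_conv_bounded_bilinear by blast

text \<open>
  At a point of \<open>I\<close> that is not isolated, the derivative within \<open>I\<close> is unique.  This is what
  allows the value of \<^const>\<open>deriv_on\<close> to be read off from a differentiation rule.
\<close>
locale perfect_domain =
  fixes I :: "real set"
  assumes at_within_ne_bot: "t \<in> I \<Longrightarrow> at t within I \<noteq> bot"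
begin

lemma deriv_on_eq:
  "(f has_vector_derivative d) (at t within I) \<Longrightarrow> t \<in> I \<Longrightarrow> deriv_on I f t = d"
  unfolding deriv_on_def by (intro vector_derivative_within at_within_ne_bot)

text \<open>
  Iterated derivatives are computed with this rule: a derivative on \<open>I\<close> is known only through
  a formula valid at the points of \<open>I\<close>, and that is all that the next derivative sees.
\<close>
lemma deriv_on_cong:
  assumes "t \<in> I" and "\<And>s. s \<in> I \<Longrightarrow> f s = g s"
    and "(g has_vector_derivative d) (at t within I)"
  shows "deriv_on I f t = d"
  by (intro deriv_on_eq has_vector_derivative_transform[of t I f g]) (use assms in auto)

text \<open>
  By uniqueness of derivatives, the existential derivative in \<^const>\<open>times_differentiable\<close>
  agrees on \<open>I\<close> with \<^const>\<open>deriv_on\<close>, so that the rules above transfer to \<^const>\<open>smooth_on\<close>.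
\<close>
lemma smooth_on_iff: "smooth_on I f \<longleftrightarrow> (\<forall>k. times_differentiable I k f)"
proof -
  have der: "(f has_vector_derivative deriv_on I f t) (at t within I)"
    if "f differentiable_on I" "t \<in> I" for f :: "real \<Rightarrow> 'a" and t
    using that unfolding differentiable_on_def deriv_on_def by (simp add: vector_derivative_works)
  have *: "times_differentiable I (Suc k) f \<longleftrightarrow>
      (\<forall>j\<le>k. ((deriv_on I) ^^ j) f differentiable_on I)" for k and f :: "real \<Rightarrow> 'a"
  proof (induction k arbitrary: f)
    case 0
    then show ?case
      using der by (auto simp: differentiable_on_def differentiableI_vector)
  next
    case (Suc k)
    have "times_differentiable I (Suc (Suc k)) f \<longleftrightarrow>
        f differentiable_on I \<and> times_differentiable I (Suc k) (deriv_on I f)"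
    proof
      assume "times_differentiable I (Suc (Suc k)) f"
      then obtain g where g: "\<forall>t\<in>I. (f has_vector_derivative g t) (at t within I)"
        "times_differentiable I (Suc k) g" unfolding times_differentiable.simps(2)[of _ "Suc k"] by blast
      have "times_differentiable I (Suc k) (deriv_on I f)"
        by (rule times_differentiable_cong[OF _ g(2)]) (use g(1) deriv_on_eq in force)
      with g show "f differentiable_on I \<and> times_differentiable I (Suc k) (deriv_on I f)"
        by (auto simp: differentiable_on_def intro: differentiableI_vector)
    next
      assume "f differentiable_on I \<and> times_differentiable I (Suc k) (deriv_on I f)"
      then show "times_differentiable I (Suc (Suc k)) f"
        using der times_differentiable.simps(2)[of I "Suc k" f] by blast
    qed
    also have "\<dots> \<longleftrightarrow> (\<forall>j\<le>Suc k. ((deriv_on I) ^^ j) f differentiable_on I)"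
      unfolding Suc.IH
      by (auto simp: less_Suc_eq_le[symmetric] All_less_Suc2 funpow_Suc_right simp del: funpow.simps(2))
    finally show ?case .
  qed
  show ?thesis
    unfolding smooth_on_def using *[of _ f] times_differentiable_mono by blast
qed

lemma smooth_on_deriv:
  assumes "smooth_on I f"
  shows "smooth_on I (deriv_on I f)"
  unfolding smooth_on_def
proof
  fix k
  show "((deriv_on I) ^^ k) (deriv_on I f) differentiable_on I"
    using assms[unfolded smooth_on_def, rule_format, of "Suc k"]
    by (simp add: funpow_Suc_right del: funpow.simps(2))
qed

lemma smooth_on_has_derivative:
  assumes "smooth_on I f" "t \<in> I"
  shows "(f has_vector_derivative deriv_on I f t) (at t within I)"
proof -
  have "f differentiable_on I" using assms(1)[unfolded smooth_on_def, rule_format, of 0] by simp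
  with assms(2) show ?thesis
    unfolding differentiable_on_def deriv_on_def by (simp add: vector_derivative_works)
qed

lemma smooth_on_cong:
  "smooth_on I f \<Longrightarrow> (\<And>t. t \<in> I \<Longrightarrow> g t = f t) \<Longrightarrow> smooth_on I g"
  unfolding smooth_on_iff using times_differentiable_cong[of I f g] by auto

lemma smooth_on_bilinear:
  "bounded_bilinear pr \<Longrightarrow> smooth_on I f \<Longrightarrow> smooth_on I g \<Longrightarrow> smooth_on I (\<lambda>t. pr (f t) (g t))"
  unfolding smooth_on_iff using times_differentiable_bilinear by blast

lemma smooth_on_linear:
  "bounded_linear L \<Longrightarrow> smooth_on I f \<Longrightarrow> smooth_on I (\<lambda>t. L (f t))"
  unfolding smooth_on_iff using times_differentiable_linear by blast

lemmas smooth_on_mult = smooth_on_bilinear[OF bounded_bilinear_mult]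
  and smooth_on_scaleR = smooth_on_bilinear[OF bounded_bilinear_scaleR]
  and smooth_on_inner = smooth_on_bilinear[OF bounded_bilinear_inner]
  and smooth_on_cross = smooth_on_bilinear[OF bounded_bilinear_cross3]

lemma smooth_on_add:
  "smooth_on I f \<Longrightarrow> smooth_on I g \<Longrightarrow> smooth_on I (\<lambda>t. f t + g t)"
  unfolding smooth_on_iff using times_differentiable_add by blast

lemma smooth_on_inverse:
  "smooth_on I f \<Longrightarrow> (\<And>t. t \<in> I \<Longrightarrow> f t \<noteq> (0::real)) \<Longrightarrow> smooth_on I (\<lambda>t. inverse (f t))"
  unfolding smooth_on_iff using times_differentiable_inverse by blast

lemma smooth_on_norm:
  "smooth_on I f \<Longrightarrow> (\<And>t. t \<in> I \<Longrightarrow> f t \<noteq> 0) \<Longrightarrow> smooth_on I (\<lambda>t. norm (f t))"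
  for f :: "real \<Rightarrow> 'a::real_inner"
  unfolding smooth_on_iff using times_differentiable_norm by blast

lemma smooth_on_Pair_iff:
  "smooth_on I (\<lambda>t. (f t, g t)) \<longleftrightarrow> smooth_on I f \<and> smooth_on I g"
proof (intro iffI conjI)
  assume p: "smooth_on I (\<lambda>t. (f t, g t))"
  show "smooth_on I f" using smooth_on_linear[OF bounded_linear_fst p] by simp
  show "smooth_on I g" using smooth_on_linear[OF bounded_linear_snd p] by simp
qed (auto simp: smooth_on_iff intro: times_differentiable_Pair)

lemma smooth_on_antiderivative:
  assumes "\<And>t. t \<in> I \<Longrightarrow> (f has_vector_derivative g t) (at t within I)" and "smooth_on I g"
  shows "smooth_on I f"
  unfolding smooth_on_iff
proof
  fix k
  have "times_differentiable I (Suc k) f"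
    using assms by (auto simp: smooth_on_iff)
  then show "times_differentiable I k f" by (rule times_differentiable_mono)
qed

text \<open>
  Differentiating a constant inner product gives the skew-symmetry behind the Frenet formulas.
\<close>
lemma inner_derivative_const:
  assumes "\<And>s. s \<in> I \<Longrightarrow> X s \<bullet> Y s = c" and "t \<in> I"
    and "(X has_vector_derivative X') (at t within I)" "(Y has_vector_derivative Y') (at t within I)"
  shows "X' \<bullet> Y t = - (X t \<bullet> Y')"
proof -
  have "((\<lambda>s. X s \<bullet> Y s) has_vector_derivative X t \<bullet> Y' + X' \<bullet> Y t) (at t within I)"
    by (rule bounded_bilinear.has_vector_derivative[OF bounded_bilinear_inner]) fact+
  then have "deriv_on I (\<lambda>s. X s \<bullet> Y s) t = X t \<bullet> Y' + X' \<bullet> Y t"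
    using assms(2) by (rule deriv_on_eq)
  moreover have "deriv_on I (\<lambda>s. X s \<bullet> Y s) t = 0"
    by (rule deriv_on_cong[where g = "\<lambda>_. c"]) (use assms in auto)
  ultimately show ?thesis by simp
qed

end

lemma cross3_cross3: "x \<times> (y \<times> z) = (x \<bullet> z) *\<^sub>R y - (x \<bullet> y) *\<^sub>R z" for x y z :: "real^3"
  by (simp add: cross3_simps forall_3)

lemma cross3_inner_rotate: "(x \<times> y) \<bullet> z = x \<bullet> (y \<times> z)" for x y z :: "real^3"
  by (simp add: cross3_simps)

text \<open>
  The remainder of \<open>x\<close> after subtracting its three components is orthogonal to \<open>T\<close> and \<open>B\<close>, so it
  has zero cross product with \<open>B \<times> T\<close>; as it is orthogonal to that vector too, it vanishes.
\<close>
lemma orthonormal_expansion: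
  fixes x T B :: "real^3"
  assumes "T \<bullet> T = 1" "B \<bullet> B = 1" "B \<bullet> T = 0"
  shows "x = (x \<bullet> T) *\<^sub>R T + (x \<bullet> (B \<times> T)) *\<^sub>R (B \<times> T) + (x \<bullet> B) *\<^sub>R B"
proof -
  have NN: "(B \<times> T) \<bullet> (B \<times> T) = 1"
    using norm_cross_dot[of B T] assms by (simp add: power_mult_distrib power2_norm_eq_inner)
  define y where "y = x - ((x \<bullet> T) *\<^sub>R T + (x \<bullet> (B \<times> T)) *\<^sub>R (B \<times> T) + (x \<bullet> B) *\<^sub>R B)"
  have y: "y \<bullet> T = 0" "y \<bullet> B = 0" "y \<bullet> (B \<times> T) = 0"
    using assms NN by (simp_all add: y_def inner_simps dot_cross_self inner_commute[of T B])
  then have "y \<times> (B \<times> T) = 0" by (simp add: cross3_cross3)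
  with y(3) have "y = 0 \<or> B \<times> T = 0" by (metis norm_and_cross_eq_0)
  with NN have "y = 0" by auto
  then show ?thesis by (simp add: y_def)
qed

section \<open>The Frenet formulas\<close>

locale frenet_curve = perfect_domain I for I +
  fixes \<gamma> :: "real \<Rightarrow> real^3"
  assumes nondegenerate: "nondegenerate I \<gamma>"
    and torsion_nonzero: "t \<in> I \<Longrightarrow> torsion I \<gamma> t \<noteq> 0"
begin

text \<open>
  The letters \<open>v\<close>, \<open>a\<close>, \<open>j\<close> stand for velocity, acceleration and jerk.  For a curve that is not
  parametrised by arc length, curvature and torsion enter the Frenet formulas multiplied by
  the speed; these products are \<open>p\<close> and \<open>q\<close>.
\<close>
abbreviation "v \<equiv> deriv_on I \<gamma>"
abbreviation "a \<equiv> deriv_on I v"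
abbreviation "j \<equiv> deriv_on I a"
abbreviation "w \<equiv> velocity_cross_accel I \<gamma>"
abbreviation "T \<equiv> unit_tangent I \<gamma>"
abbreviation "N \<equiv> principal_normal I \<gamma>"
abbreviation "B \<equiv> binormal I \<gamma>"
abbreviation "\<kappa> \<equiv> curvature I \<gamma>"
abbreviation "\<tau> \<equiv> torsion I \<gamma>"
abbreviation "p t \<equiv> speed I \<gamma> t * \<kappa> t"
abbreviation "q t \<equiv> speed I \<gamma> t * \<tau> t"

lemma smooth_curve: "smooth_on I \<gamma>"
  using nondegenerate by (simp add: nondegenerate_def)

lemma velocity_nonzero: "t \<in> I \<Longrightarrow> v t \<noteq> 0" and w_nonzero: "t \<in> I \<Longrightarrow> w t \<noteq> 0"
  using nondegenerate by (simp_all add: nondegenerate_def)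

lemma speed_pos: "t \<in> I \<Longrightarrow> speed I \<gamma> t > 0"
  and curvature_pos: "t \<in> I \<Longrightarrow> \<kappa> t > 0"
  using velocity_nonzero w_nonzero by (simp_all add: speed_def curvature_def)

lemma torsion_eq: "\<tau> t = (w t \<bullet> j t) / norm (w t) ^ 2"
  by (simp add: torsion_def velocity_cross_accel_def dot_cross_det cross3_inner_rotate)

lemmas smooth_velocity = smooth_on_deriv[OF smooth_curve]
lemmas smooth_accel = smooth_on_deriv[OF smooth_velocity]
lemmas smooth_jerk = smooth_on_deriv[OF smooth_accel]

lemma smooth_w: "smooth_on I w"
  unfolding velocity_cross_accel_def[abs_def] by (intro smooth_on_cross smooth_velocity smooth_accel)

lemma smooth_speed: "smooth_on I (speed I \<gamma>)"
  unfolding speed_def[abs_def] by (intro smooth_on_norm smooth_velocity velocity_nonzero)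

lemma smooth_inverse_speed: "smooth_on I (\<lambda>t. inverse (speed I \<gamma> t))"
  by (rule smooth_on_inverse[OF smooth_speed]) (use speed_pos in force)

lemma smooth_norm_w: "smooth_on I (\<lambda>t. norm (w t))"
  by (intro smooth_on_norm smooth_w w_nonzero)

lemma smooth_inverse_norm_w: "smooth_on I (\<lambda>t. inverse (norm (w t)))"
  by (rule smooth_on_inverse[OF smooth_norm_w]) (use w_nonzero in auto)

lemma smooth_curvature: "smooth_on I \<kappa>"
proof (rule smooth_on_cong)
  show "smooth_on I (\<lambda>t. norm (w t) * (inverse (speed I \<gamma> t) * (inverse (speed I \<gamma> t) * inverse (speed I \<gamma> t))))"
    by (intro smooth_on_mult smooth_norm_w smooth_inverse_speed)
qed (simp add: curvature_def field_simps power3_eq_cube)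

lemma smooth_torsion: "smooth_on I \<tau>"
proof (rule smooth_on_cong)
  show "smooth_on I (\<lambda>t. (w t \<bullet> j t) * (inverse (norm (w t)) * inverse (norm (w t))))"
    by (intro smooth_on_mult smooth_on_inner smooth_w smooth_jerk smooth_inverse_norm_w)
qed (simp add: torsion_eq field_simps power2_eq_square)

lemma smooth_tangent: "smooth_on I T"
  unfolding unit_tangent_def[abs_def] by (intro smooth_on_scaleR smooth_inverse_speed smooth_velocity)

lemma smooth_binormal: "smooth_on I B"
  unfolding binormal_def[abs_def] by (intro smooth_on_scaleR smooth_inverse_norm_w smooth_w)

lemma smooth_q: "smooth_on I q"
  by (intro smooth_on_mult smooth_speed smooth_torsion)

lemma p_pos: "t \<in> I \<Longrightarrow> p t > 0" and q_nonzero: "t \<in> I \<Longrightarrow> q t \<noteq> 0"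
  using speed_pos curvature_pos torsion_nonzero by (simp, force)

lemma w_orthogonal: "w t \<bullet> v t = 0" "w t \<bullet> a t = 0"
  by (simp_all add: velocity_cross_accel_def dot_cross_self)

lemma frame_inner:
  assumes "t \<in> I"
  shows "T t \<bullet> T t = 1" "B t \<bullet> B t = 1" "N t \<bullet> N t = 1"
    "B t \<bullet> T t = 0" "T t \<bullet> B t = 0" "T t \<bullet> N t = 0" "N t \<bullet> T t = 0" "N t \<bullet> B t = 0" "B t \<bullet> N t = 0"
proof -
  show T: "T t \<bullet> T t = 1" and B: "B t \<bullet> B t = 1"
    using velocity_nonzero[OF assms] w_nonzero[OF assms]
    by (simp_all add: unit_tangent_def binormal_def speed_def flip: power2_norm_eq_inner)
  show BT: "B t \<bullet> T t = 0"
    by (simp add: unit_tangent_def binormal_def w_orthogonal)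
  then show "T t \<bullet> B t = 0" by (simp add: inner_commute)
  show "N t \<bullet> N t = 1"
    using norm_cross_dot[of "B t" "T t"] T B BT
    by (simp add: principal_normal_def power_mult_distrib power2_norm_eq_inner)
qed (simp_all add: principal_normal_def dot_cross_self)

lemma norm_frame: "t \<in> I \<Longrightarrow> norm (T t) = 1" "t \<in> I \<Longrightarrow> norm (B t) = 1"
  using frame_inner by (simp_all add: norm_eq_1)
lemma frame_cross:
  assumes "t \<in> I"
  shows "T t \<times> N t = B t" "N t \<times> B t = T t" "B t \<times> T t = N t"
    "N t \<times> T t = - B t" "B t \<times> N t = - T t" "T t \<times> B t = - N t"
proof -
  show 1: "T t \<times> N t = B t" and 2: "B t \<times> N t = - T t"
    using frame_inner[OF assms] by (simp_all add: principal_normal_def cross3_cross3)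
  show 3: "B t \<times> T t = N t" by (simp add: principal_normal_def)
  show "N t \<times> B t = T t" "N t \<times> T t = - B t" "T t \<times> B t = - N t"
    using 1 2 3 by (metis cross_skew minus_minus)+
qed

lemma frame_expansion:
  "t \<in> I \<Longrightarrow> x = (x \<bullet> T t) *\<^sub>R T t + (x \<bullet> N t) *\<^sub>R N t + (x \<bullet> B t) *\<^sub>R B t"
  using orthonormal_expansion[of "T t" "B t" x] frame_inner[of t] by (simp add: principal_normal_def)

lemma velocity_eq: "t \<in> I \<Longrightarrow> v t = speed I \<gamma> t *\<^sub>R T t"
  using speed_pos[of t] by (simp add: unit_tangent_def)

text \<open>
  The \<open>T\<close>-component of \<open>T'\<close> vanishes as \<open>T\<close> has unit length, and the \<open>B\<close>-component vanishes as
  \<open>T'\<close> is a combination of velocity and acceleration, both orthogonal to \<open>B\<close>.  What remains is the \<open>N\<close>-component \<open>|w| / |v|\<^sup>2\<close>.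
\<close>
lemma tangent_derivative:
  assumes t: "t \<in> I"
  shows "(T has_vector_derivative p t *\<^sub>R N t) (at t within I)"
proof -
  define T' where "T' = deriv_on I T t"
  have T': "(T has_vector_derivative T') (at t within I)"
    unfolding T'_def by (rule smooth_on_has_derivative[OF smooth_tangent t])
  let ?d = "deriv_on I (\<lambda>t. inverse (speed I \<gamma> t)) t"
  have "(T has_vector_derivative inverse (speed I \<gamma> t) *\<^sub>R a t + ?d *\<^sub>R v t) (at t within I)"
    unfolding unit_tangent_def[abs_def]
    by (intro bounded_bilinear.has_vector_derivative[OF bounded_bilinear_scaleR]
        smooth_on_has_derivative smooth_inverse_speed smooth_velocity t)
  then have T'_eq: "T' = inverse (speed I \<gamma> t) *\<^sub>R a t + ?d *\<^sub>R v t"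
    unfolding T'_def using t by (rule deriv_on_eq)
  have "T' \<bullet> T t = 0"
    using inner_derivative_const[OF frame_inner(1) t T' T'] by (simp add: inner_commute)
  moreover have "T' \<bullet> B t = 0"
    using w_orthogonal[of t] by (simp add: T'_eq binormal_def inner_simps inner_commute)
  moreover have "T' \<bullet> N t = p t"
  proof -
    have "a t \<bullet> (w t \<times> v t) = (norm (w t))\<^sup>2"
      unfolding power2_norm_eq_inner
      by (simp add: velocity_cross_accel_def cross3_inner_rotate[symmetric])
         (metis cross_skew inner_minus_left inner_minus_right cross3_inner_rotate inner_commute)
    moreover have "v t \<bullet> (w t \<times> v t) = 0" by (simp add: dot_cross_self)
    ultimately show ?thesis
      using speed_pos[OF t] w_nonzero[OF t]
      by (simp add: T'_eq principal_normal_def binormal_def unit_tangent_def inner_simps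
          cross_mult_left cross_mult_right curvature_def power2_eq_square power3_eq_cube field_simps)
  qed
  ultimately have "T' = p t *\<^sub>R N t" using frame_expansion[OF t, of T'] by simp
  with T' show ?thesis by simp
qed

text \<open>
  The term \<open>a \<times> a\<close> drops out of \<open>w'\<close>, leaving \<open>v \<times> j\<close>, which is orthogonal to \<open>T\<close>.  So only the
  \<open>N\<close>-component of \<open>B'\<close> survives, and the Binet-Cauchy identity turns it into the determinant in
  the torsion.
\<close>
lemma binormal_derivative:
  assumes t: "t \<in> I"
  shows "(B has_vector_derivative - (q t *\<^sub>R N t)) (at t within I)"
proof -
  define B' where "B' = deriv_on I B t"
  have B': "(B has_vector_derivative B') (at t within I)"
    unfolding B'_def by (rule smooth_on_has_derivative[OF smooth_binormal t])
  let ?d = "deriv_on I (\<lambda>t. inverse (norm (w t))) t"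
  have "(w has_vector_derivative v t \<times> j t + a t \<times> a t) (at t within I)"
    unfolding velocity_cross_accel_def[abs_def]
    by (intro bounded_bilinear.has_vector_derivative[OF bounded_bilinear_cross3]
        smooth_on_has_derivative smooth_accel smooth_velocity t)
  then have "(w has_vector_derivative v t \<times> j t) (at t within I)" by simp
  then have "(B has_vector_derivative inverse (norm (w t)) *\<^sub>R (v t \<times> j t) + ?d *\<^sub>R w t) (at t within I)"
    unfolding binormal_def[abs_def]
    by (intro bounded_bilinear.has_vector_derivative[OF bounded_bilinear_scaleR]
        smooth_on_has_derivative smooth_inverse_norm_w t)
  then have B'_eq: "B' = inverse (norm (w t)) *\<^sub>R (v t \<times> j t) + ?d *\<^sub>R w t"
    unfolding B'_def using t by (rule deriv_on_eq)
  have "B' \<bullet> B t = 0"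
    using inner_derivative_const[OF frame_inner(2) t B' B'] by (simp add: inner_commute)
  moreover have "B' \<bullet> T t = 0"
    by (simp add: B'_eq unit_tangent_def inner_simps w_orthogonal dot_cross_self)
  moreover have "B' \<bullet> N t = - q t"
  proof -
    have "(v t \<times> j t) \<bullet> (w t \<times> v t) = (j t \<bullet> v t) * (v t \<bullet> w t) - (j t \<bullet> w t) * (v t \<bullet> v t)"
      by (simp add: cross3_simps)
    also have "\<dots> = - ((w t \<bullet> j t) * (speed I \<gamma> t)\<^sup>2)"
      using w_orthogonal(1)[of t] by (simp add: inner_commute speed_def power2_norm_eq_inner)
    finally have "(v t \<times> j t) \<bullet> (w t \<times> v t) = - ((w t \<bullet> j t) * (speed I \<gamma> t)\<^sup>2)" .
    moreover have "w t \<bullet> (w t \<times> v t) = 0" by (simp add: dot_cross_self)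
    ultimately show ?thesis
      using speed_pos[OF t] w_nonzero[OF t]
      by (simp add: B'_eq principal_normal_def binormal_def unit_tangent_def inner_simps
          cross_mult_left cross_mult_right torsion_eq power2_eq_square field_simps)
  qed
  ultimately have "B' = - (q t *\<^sub>R N t)" using frame_expansion[OF t, of B'] by simp
  with B' show ?thesis by simp
qed

text \<open>
  The remaining formula is the product rule for \<open>N = B \<times> T\<close>.
\<close>
lemma normal_derivative:
  assumes t: "t \<in> I"
  shows "(N has_vector_derivative q t *\<^sub>R B t - p t *\<^sub>R T t) (at t within I)"
proof -
  have "((\<lambda>t. B t \<times> T t) has_vector_derivative B t \<times> (p t *\<^sub>R N t) + (- (q t *\<^sub>R N t)) \<times> T t) (at t within I)"
    by (rule bounded_bilinear.has_vector_derivative[OF bounded_bilinear_cross3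
          binormal_derivative[OF t] tangent_derivative[OF t]])
  also have "B t \<times> (p t *\<^sub>R N t) + (- (q t *\<^sub>R N t)) \<times> T t = q t *\<^sub>R B t - p t *\<^sub>R T t"
    by (simp add: cross_mult_left cross_mult_right frame_cross[OF t])
  finally show ?thesis by (simp add: principal_normal_def[of I \<gamma>, abs_def])
qed

section \<open>Curves moving along the binormal of another curve\<close>

text \<open>
  Involutes and evolutes of \<open>\<gamma>\<close> are both curves \<open>\<sigma>\<close> with \<open>\<sigma>' = u B\<close>.  Everything about such a curve
  is determined by \<open>u\<close>, \<open>p\<close> and \<open>q\<close>: its tangent is \<open>B\<close>, its binormal is \<open>T\<close> and its principal normal
  is \<open>N\<close>, each up to a sign, and the roles of curvature and torsion are exchanged.
\<close>
context
  fixes \<sigma> :: "real \<Rightarrow> real^3" and u :: "real \<Rightarrow> real"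
  assumes smooth_u: "smooth_on I u"
    and u_nonzero: "\<And>t. t \<in> I \<Longrightarrow> u t \<noteq> 0"
    and \<sigma>_derivative: "\<And>t. t \<in> I \<Longrightarrow> (\<sigma> has_vector_derivative u t *\<^sub>R B t) (at t within I)"
begin

lemma binormal_curve_velocity:
  "t \<in> I \<Longrightarrow> deriv_on I \<sigma> t = u t *\<^sub>R B t"
  using \<sigma>_derivative by (rule deriv_on_eq)

lemma binormal_curve_accel:
  assumes t: "t \<in> I"
  shows "deriv_on I (deriv_on I \<sigma>) t = deriv_on I u t *\<^sub>R B t - (u t * q t) *\<^sub>R N t"
proof -
  have "((\<lambda>t. u t *\<^sub>R B t) has_vector_derivative
      u t *\<^sub>R (- (q t *\<^sub>R N t)) + deriv_on I u t *\<^sub>R B t) (at t within I)"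
    by (intro bounded_bilinear.has_vector_derivative[OF bounded_bilinear_scaleR]
        smooth_on_has_derivative smooth_u t binormal_derivative)
  from deriv_on_cong[OF t binormal_curve_velocity this] show ?thesis by simp
qed

text \<open>
  As the cross product of velocity and acceleration points along \<open>T\<close>, the \<open>T\<close>-component is all
  that the torsion needs of the third derivative.
\<close>
lemma binormal_curve_jerk:
  assumes t: "t \<in> I"
  shows "deriv_on I (deriv_on I (deriv_on I \<sigma>)) t \<bullet> T t = u t * q t * p t"
proof -
  have "((\<lambda>t. deriv_on I u t *\<^sub>R B t - (u t * q t) *\<^sub>R N t) has_vector_derivative
      (deriv_on I u t *\<^sub>R (- (q t *\<^sub>R N t)) + deriv_on I (deriv_on I u) t *\<^sub>R B t)
      - ((u t * q t) *\<^sub>R (q t *\<^sub>R B t - p t *\<^sub>R T t) + deriv_on I (\<lambda>t. u t * q t) t *\<^sub>R N t)) (at t within I)"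
    by (intro has_vector_derivative_diff bounded_bilinear.has_vector_derivative[OF bounded_bilinear_scaleR]
        smooth_on_has_derivative smooth_on_deriv smooth_on_mult smooth_u smooth_speed smooth_torsion
        t binormal_derivative normal_derivative)
  from deriv_on_cong[OF t binormal_curve_accel this] show ?thesis
    by (simp add: inner_simps frame_inner[OF t])
qed

lemma binormal_curve_velocity_cross_accel:
  assumes t: "t \<in> I"
  shows "velocity_cross_accel I \<sigma> t = ((u t)\<^sup>2 * q t) *\<^sub>R T t"
  using t by (simp add: velocity_cross_accel_def binormal_curve_velocity binormal_curve_accel
      Cross3.right_diff_distrib cross_mult_left cross_mult_right frame_cross power2_eq_square)

lemma binormal_curve_nondegenerate: "nondegenerate I \<sigma>"
proof -
  have "smooth_on I \<sigma>"
    by (rule smooth_on_antiderivative[OF \<sigma>_derivative])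
       (auto intro: smooth_on_scaleR smooth_u smooth_binormal)
  moreover have "T t \<noteq> 0" "B t \<noteq> 0" if "t \<in> I" for t
    using norm_frame[OF that] by auto
  ultimately show ?thesis
    using u_nonzero q_nonzero
    by (auto simp: nondegenerate_def binormal_curve_velocity binormal_curve_velocity_cross_accel)
qed

lemma binormal_curve_speed: "t \<in> I \<Longrightarrow> speed I \<sigma> t = \<bar>u t\<bar>"
  by (simp add: speed_def binormal_curve_velocity norm_frame)

lemma binormal_curve_curvature: "t \<in> I \<Longrightarrow> curvature I \<sigma> t = \<bar>q t\<bar> / \<bar>u t\<bar>"
  using u_nonzero[of t]
  by (simp add: curvature_def binormal_curve_speed binormal_curve_velocity_cross_accel norm_frame
      abs_mult power2_eq_square power3_eq_cube)

lemma binormal_curve_torsion: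
  assumes t: "t \<in> I"
  shows "torsion I \<sigma> t = p t / u t"
proof -
  have "det (vector [deriv_on I \<sigma> t, deriv_on I (deriv_on I \<sigma>) t,
      deriv_on I (deriv_on I (deriv_on I \<sigma>)) t] :: real^3^3) = (u t)\<^sup>2 * q t * (u t * q t * p t)"
    using binormal_curve_jerk[OF t] binormal_curve_velocity_cross_accel[OF t]
    by (simp add: dot_cross_det[symmetric] cross3_inner_rotate[symmetric] velocity_cross_accel_def
       inner_commute)
  then have "torsion I \<sigma> t = (u t)\<^sup>2 * q t * (u t * q t * p t) / ((u t)\<^sup>2 * q t)\<^sup>2"
    by (simp add: torsion_def[of I \<sigma>] binormal_curve_velocity_cross_accel[OF t] norm_frame t)
  also have "\<dots> = p t / u t"
  proof -
    have "x\<^sup>2 * y * (x * y * z) / (x\<^sup>2 * y)\<^sup>2 = z / x" if "x \<noteq> 0" "y \<noteq> 0" for x y z :: real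
      using that by (simp add: power2_eq_square field_simps)
    then show ?thesis using u_nonzero[OF t] q_nonzero[OF t] by blast
  qed
  finally show ?thesis .
qed

lemma binormal_curve_frame:
  assumes t: "t \<in> I"
  shows "unit_tangent I \<sigma> t = sgn (u t) *\<^sub>R B t"
    and "binormal I \<sigma> t = sgn (q t) *\<^sub>R T t"
    and "principal_normal I \<sigma> t = - ((sgn (u t) * sgn (q t)) *\<^sub>R N t)"
proof -
  show 1: "unit_tangent I \<sigma> t = sgn (u t) *\<^sub>R B t"
    using t by (simp add: unit_tangent_def binormal_curve_velocity binormal_curve_speed sgn_div_norm divide_inverse
      mult.commute)
  have "inverse (\<bar>x\<^sup>2 * y\<bar>) * (x\<^sup>2 * y) = sgn y" if "x \<noteq> 0" for x y :: real
    using that by (simp add: abs_mult field_simps sgn_if)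
  from this[OF u_nonzero[OF t], of "q t"]
  show 2: "binormal I \<sigma> t = sgn (q t) *\<^sub>R T t"
    using t by (simp add: binormal_def binormal_curve_velocity_cross_accel norm_frame)
  show "principal_normal I \<sigma> t = - ((sgn (u t) * sgn (q t)) *\<^sub>R N t)"
    using 1 2 by (simp add: principal_normal_def[of I \<sigma>] cross_mult_left cross_mult_right frame_cross[OF t] mult.commute)
qed

end

end

context frenet_curve begin

section \<open>The evolute of an involute\<close>

text \<open>
  The two equations of an involute pair say exactly that the components of the derivative along
  \<open>T\<close> and \<open>N\<close> vanish.
\<close>
lemma involute_derivative:
  assumes pair: "involute_pair I \<gamma> lam eta" and t: "t \<in> I"
  shows "(involute I \<gamma> lam eta has_vector_derivative (eta t * q t) *\<^sub>R B t) (at t within I)"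
proof -
  from pair have smooth: "smooth_on I lam" "smooth_on I eta"
    by (simp_all add: involute_pair_def smooth_on_Pair_iff)
  have "((\<lambda>t. \<gamma> t + lam t *\<^sub>R T t + eta t *\<^sub>R N t) has_vector_derivative
      v t + (lam t *\<^sub>R (p t *\<^sub>R N t) + deriv_on I lam t *\<^sub>R T t)
      + (eta t *\<^sub>R (q t *\<^sub>R B t - p t *\<^sub>R T t) + deriv_on I eta t *\<^sub>R N t)) (at t within I)"
    by (intro has_vector_derivative_add bounded_bilinear.has_vector_derivative[OF bounded_bilinear_scaleR]
        smooth_on_has_derivative smooth_curve smooth tangent_derivative normal_derivative t)
  also have "v t + (lam t *\<^sub>R (p t *\<^sub>R N t) + deriv_on I lam t *\<^sub>R T t)
      + (eta t *\<^sub>R (q t *\<^sub>R B t - p t *\<^sub>R T t) + deriv_on I eta t *\<^sub>R N t)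
    = (speed I \<gamma> t + deriv_on I lam t - eta t * p t) *\<^sub>R T t
      + (lam t * p t + deriv_on I eta t) *\<^sub>R N t + (eta t * q t) *\<^sub>R B t"
    by (simp only: velocity_eq[OF t]) (simp add: algebra_simps)
  also have "\<dots> = (eta t * q t) *\<^sub>R B t"
    using pair t by (simp add: involute_pair_def mult.assoc)
  finally show ?thesis
    by (simp add: involute_def[abs_def])
qed

text \<open>
  Here \<open>u = eta q\<close>, so the curvature \<open>|q| / |u|\<close> of the involute is \<open>1 / |eta|\<close>.  The first correction
  term of its evolute is therefore \<open>- eta N\<close>.  The second one contains the derivative of
  \<open>1 / |eta|\<close>, and the equation \<open>eta' = - lam p\<close> turns it into \<open>- lam T\<close>.  Together they undo the
  involute.
\<close>
lemma evolute_involute: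
  assumes pair: "involute_pair I \<gamma> lam eta"
  shows "evolute_exists I (involute I \<gamma> lam eta)"
    and "\<And>t. t \<in> I \<Longrightarrow> evolute I (involute I \<gamma> lam eta) t = \<gamma> t"
proof -
  let ?\<sigma> = "involute I \<gamma> lam eta" and ?u = "\<lambda>t. eta t * q t"
  have eta: "smooth_on I eta" "\<And>t. t \<in> I \<Longrightarrow> eta t \<noteq> 0"
    using pair by (simp_all add: involute_pair_def smooth_on_Pair_iff)
  have u: "smooth_on I ?u" "\<And>t. t \<in> I \<Longrightarrow> ?u t \<noteq> 0"
    using eta q_nonzero by (auto intro: smooth_on_mult smooth_q)
  note \<sigma> = u involute_derivative[OF pair]
  show "evolute_exists I ?\<sigma>"
    using binormal_curve_nondegenerate[OF \<sigma>] binormal_curve_torsion[OF \<sigma>] u(2) p_pos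
    by (fastforce simp: evolute_exists_def)
  fix t assume t: "t \<in> I"
  have \<kappa>: "curvature I ?\<sigma> s = inverse (norm (eta s))" if "s \<in> I" for s
    using binormal_curve_curvature[OF \<sigma> that] q_nonzero[OF that] eta(2)[OF that]
    by (simp add: abs_mult field_simps)
  have eta': "deriv_on I eta t = - (lam t * p t)"
    using pair t by (simp add: involute_pair_def eq_neg_iff_add_eq_0 mult.assoc add.commute)
  have "((\<lambda>s. inverse (norm (eta s))) has_vector_derivative
     - ((deriv_on I eta t \<bullet> eta t) * inverse (norm (eta t)) * (inverse (norm (eta t)) * inverse (norm (eta t)))))
     (at t within I)"
    using eta t by (intro has_vector_derivative_inverse has_vector_derivative_norm
        smooth_on_has_derivative) auto
  note d\<kappa> = deriv_on_cong[OF t \<kappa> this]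
  have \<kappa>': "deriv_on I (curvature I ?\<sigma>) t = lam t * p t * eta t / \<bar>eta t\<bar> ^ 3"
  proof -
    have "- (((- x) \<bullet> y) * inverse z * (inverse z * inverse z)) = x * y / z ^ 3" for x y z :: real
      by (simp add: divide_inverse power3_eq_cube mult_ac)
    with d\<kappa> show ?thesis by (simp only: eta' real_norm_def)
  qed
  \<comment> \<open>The coefficient of the binormal term, where \<open>sgn (q t)\<close> comes from the binormal of the involute;
    all signs cancel.\<close>
  have b: "deriv_on I (curvature I ?\<sigma>) t / (speed I ?\<sigma> t * (curvature I ?\<sigma> t)\<^sup>2 * torsion I ?\<sigma> t)
      * sgn (q t) = lam t"
  proof -
    have "(l * x * y / \<bar>y\<bar> ^ 3) / (\<bar>y * z\<bar> * (inverse \<bar>y\<bar>)\<^sup>2 * (x / (y * z))) * sgn z = l"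
      if "x > 0" "y \<noteq> 0" "z \<noteq> 0" for l x y z :: real
      using that by (cases "y > 0"; cases "z > 0")
        (auto simp: abs_mult power2_eq_square power3_eq_cube field_simps)
    from this[OF p_pos[OF t] eta(2)[OF t] q_nonzero[OF t], of "lam t"] show ?thesis
      by (simp only: \<kappa>' \<kappa>[OF t] binormal_curve_speed[OF \<sigma> t] binormal_curve_torsion[OF \<sigma> t] real_norm_def)
  qed
  have n: "1 / curvature I ?\<sigma> t * (sgn (?u t) * sgn (q t)) = eta t"
  proof -
    have "1 / inverse \<bar>y\<bar> * (sgn (y * z) * sgn z) = y" if "z \<noteq> 0" for y z :: real
      using that by (cases "y = 0") (auto simp: sgn_if zero_less_mult_iff divide_inverse)
    from this[OF q_nonzero[OF t]] show ?thesis by (simp only: \<kappa>[OF t] real_norm_def)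
  qed
  have "evolute I ?\<sigma> t = ?\<sigma> t - eta t *\<^sub>R N t - lam t *\<^sub>R T t"
    unfolding evolute_def[of I ?\<sigma>]
    by (simp only: binormal_curve_frame[OF \<sigma> t] scaleR_scaleR scaleR_minus_right b n) simp
  then show "evolute I ?\<sigma> t = \<gamma> t" by (simp add: involute_def)
qed

section \<open>The involute of an evolute\<close>

abbreviation "L \<equiv> lambda_E I \<gamma>"
abbreviation "E \<equiv> eta_E I \<gamma>"

lemma evolute_eq: "evolute I \<gamma> t = \<gamma> t + L t *\<^sub>R N t + E t *\<^sub>R B t"
  by (simp add: evolute_def lambda_E_def eta_E_def)

lemma smooth_lambda_E: "smooth_on I L"
  unfolding lambda_E_def[abs_def] divide_inverse mult_1
  by (rule smooth_on_inverse[OF smooth_curvature]) (use curvature_pos in force)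

text \<open>
  This relation is the second equation of an involute pair, up to signs, and it is also the
  reason why the evolute has no velocity along \<open>N\<close>.
\<close>
lemma lambda_E_derivative:
  assumes t: "t \<in> I"
  shows "deriv_on I L t = E t * q t"
proof -
  have "deriv_on I L t = - (deriv_on I \<kappa> t * (inverse (\<kappa> t) * inverse (\<kappa> t)))"
    unfolding lambda_E_def[abs_def] divide_inverse mult_1
    by (intro deriv_on_eq has_vector_derivative_inverse smooth_on_has_derivative smooth_curvature t)
      (use curvature_pos[OF t] in simp)
  also have "\<dots> = E t * q t"
    using speed_pos[OF t] curvature_pos[OF t] torsion_nonzero[OF t]
    by (simp add: eta_E_def power2_eq_square field_simps)
  finally show ?thesis .
qed

lemma smooth_eta_E: "smooth_on I E"
proof (rule smooth_on_cong)
  show "smooth_on I (\<lambda>t. deriv_on I L t * inverse (q t))"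
    by (intro smooth_on_mult[OF smooth_on_deriv[OF smooth_lambda_E]] smooth_on_inverse smooth_q q_nonzero)
qed (metis lambda_E_derivative q_nonzero nonzero_mult_div_cancel_right divide_inverse)

lemma evolute_h_eq:
  assumes t: "t \<in> I"
  shows "evolute_h I \<gamma> t = L t * q t + deriv_on I E t"
proof -
  have "deriv_on I (\<lambda>s. deriv_on I \<kappa> s / \<kappa> s ^ 2 * (1 / (speed I \<gamma> s * \<tau> s))) t = - deriv_on I E t"
  proof (rule deriv_on_cong[OF t])
    show "((\<lambda>s. - E s) has_vector_derivative - deriv_on I E t) (at t within I)"
      by (intro has_vector_derivative_minus smooth_on_has_derivative smooth_eta_E t)
  qed (simp add: eta_E_def)
  then show ?thesis by (simp add: evolute_h_def lambda_E_def)
qed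

lemma smooth_evolute_h: "smooth_on I (evolute_h I \<gamma>)"
proof (rule smooth_on_cong)
  show "smooth_on I (\<lambda>t. L t * q t + deriv_on I E t)"
    by (intro smooth_on_add smooth_on_mult[OF smooth_lambda_E smooth_q] smooth_on_deriv smooth_eta_E)
qed (rule evolute_h_eq)

text \<open>
  The \<open>T\<close>-component vanishes since \<open>1 / \<kappa>\<close> is the radius of curvature, and the \<open>N\<close>-component by the
  choice of the coefficient of \<open>B\<close> in the evolute.
\<close>
lemma evolute_derivative:
  assumes t: "t \<in> I"
  shows "(evolute I \<gamma> has_vector_derivative evolute_h I \<gamma> t *\<^sub>R B t) (at t within I)"
proof -
  have "((\<lambda>t. \<gamma> t + L t *\<^sub>R N t + E t *\<^sub>R B t) has_vector_derivative
      v t + (L t *\<^sub>R (q t *\<^sub>R B t - p t *\<^sub>R T t) + deriv_on I L t *\<^sub>R N t)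
      + (E t *\<^sub>R (- (q t *\<^sub>R N t)) + deriv_on I E t *\<^sub>R B t)) (at t within I)"
    by (intro has_vector_derivative_add bounded_bilinear.has_vector_derivative[OF bounded_bilinear_scaleR]
        smooth_on_has_derivative smooth_curve smooth_lambda_E smooth_eta_E
        binormal_derivative normal_derivative t)
  also have "v t + (L t *\<^sub>R (q t *\<^sub>R B t - p t *\<^sub>R T t) + deriv_on I L t *\<^sub>R N t)
      + (E t *\<^sub>R (- (q t *\<^sub>R N t)) + deriv_on I E t *\<^sub>R B t)
    = (speed I \<gamma> t - L t * p t) *\<^sub>R T t + (deriv_on I L t - E t * q t) *\<^sub>R N t
      + evolute_h I \<gamma> t *\<^sub>R B t"
    by (simp only: velocity_eq[OF t] evolute_h_eq[OF t]) (simp add: algebra_simps)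
  also have "speed I \<gamma> t - L t * p t = 0"
    using curvature_pos[OF t] by (simp add: lambda_E_def)
  finally show ?thesis
    by (simp add: lambda_E_derivative[OF t] evolute_eq[abs_def])
qed

text \<open>
  The signs \<open>c\<close> and \<open>d\<close> of \<open>evolute_h\<close> and of the torsion are constants, which makes the four cases
  one.  The tangent of the evolute is \<open>c B\<close> and its principal normal is \<open>- c d N\<close>; the coefficients
  carry the same signs once more, so that they cancel in the involute.
\<close>
lemma involute_evolute:
  assumes c: "c = 1 \<or> c = -1" and d: "d = 1 \<or> d = -1"
    and h: "\<And>t. t \<in> I \<Longrightarrow> c * evolute_h I \<gamma> t > 0"
    and \<tau>: "\<And>t. t \<in> I \<Longrightarrow> d * \<tau> t > 0"
  shows "involute_exists I (evolute I \<gamma>) (\<lambda>t. - c * E t) (\<lambda>t. c * d * L t)"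
    and "\<And>t. t \<in> I \<Longrightarrow> involute I (evolute I \<gamma>) (\<lambda>t. - c * E t) (\<lambda>t. c * d * L t) t = \<gamma> t"
proof -
  let ?h = "evolute_h I \<gamma>"
  have h0: "\<And>t. t \<in> I \<Longrightarrow> ?h t \<noteq> 0" using h by force
  note \<sigma> = smooth_evolute_h h0 evolute_derivative
  have sgn_h: "sgn (?h t) = c" and abs_h: "\<bar>?h t\<bar> = c * ?h t" if "t \<in> I" for t
    using h[OF that] c by (auto simp: sgn_if)
  have sgn_q: "sgn (q t) = d" and abs_q: "\<bar>q t\<bar> = d * q t" if "t \<in> I" for t
  proof -
    show "sgn (q t) = d"
      using \<tau>[OF that] d speed_pos[OF that] by (auto simp: sgn_mult)
    then show "\<bar>q t\<bar> = d * q t" by (simp add: abs_sgn mult.commute)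
  qed
  have cc: "c * c = 1" and dd: "d * d = 1" using c d by auto
  have derivs: "deriv_on I (\<lambda>t. - c * E t) t = - c * deriv_on I E t"
    "deriv_on I (\<lambda>t. c * d * L t) t = c * d * deriv_on I L t" if "t \<in> I" for t
    by (intro deriv_on_eq has_vector_derivative_mult_right smooth_on_has_derivative that
        smooth_eta_E smooth_lambda_E)+
  have speed_\<kappa>: "speed I (evolute I \<gamma>) t * curvature I (evolute I \<gamma>) t = d * q t" if "t \<in> I" for t
    using h0[OF that] by (simp add: binormal_curve_speed[OF \<sigma> that] binormal_curve_curvature[OF \<sigma> that]
        abs_q[OF that])
  have "involute_pair I (evolute I \<gamma>) (\<lambda>t. - c * E t) (\<lambda>t. c * d * L t)"
    unfolding involute_pair_def
  proof (intro conjI ballI)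
    show "smooth_on I (\<lambda>t. (- c * E t, c * d * L t))"
      unfolding smooth_on_Pair_iff
      by (intro conjI smooth_on_linear[OF bounded_linear_mult_right] smooth_eta_E smooth_lambda_E)
    fix t assume t: "t \<in> I"
    show "c * d * L t \<noteq> 0" using c d curvature_pos[OF t] by (auto simp: lambda_E_def)
    have speed_h: "speed I (evolute I \<gamma>) t = c * ?h t"
      by (simp only: binormal_curve_speed[OF \<sigma> t] abs_h[OF t])
    have "speed I (evolute I \<gamma>) t + deriv_on I (\<lambda>t. - c * E t) t
        - c * d * L t * (speed I (evolute I \<gamma>) t * curvature I (evolute I \<gamma>) t)
      = c * (L t * q t) - (d * d) * (c * (L t * q t))"
      unfolding speed_\<kappa>[OF t]
      unfolding speed_h derivs[OF t] evolute_h_eq[OF t] by (simp add: algebra_simps)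
    then show "speed I (evolute I \<gamma>) t + deriv_on I (\<lambda>t. - c * E t) t
        - c * d * L t * speed I (evolute I \<gamma>) t * curvature I (evolute I \<gamma>) t = 0"
      by (simp add: dd mult.assoc)
    have "- c * E t * (speed I (evolute I \<gamma>) t * curvature I (evolute I \<gamma>) t)
        + deriv_on I (\<lambda>t. c * d * L t) t = 0"
      unfolding speed_\<kappa>[OF t] derivs[OF t] lambda_E_derivative[OF t] by simp
    then show "- c * E t * speed I (evolute I \<gamma>) t * curvature I (evolute I \<gamma>) t
        + deriv_on I (\<lambda>t. c * d * L t) t = 0"
      by (simp only: mult.assoc)
  qed
  then show "involute_exists I (evolute I \<gamma>) (\<lambda>t. - c * E t) (\<lambda>t. c * d * L t)"
    using binormal_curve_nondegenerate[OF \<sigma>] binormal_curve_torsion[OF \<sigma>] h0 p_pos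
    by (fastforce simp: involute_exists_def)
  fix t assume t: "t \<in> I"
  have "involute I (evolute I \<gamma>) (\<lambda>t. - c * E t) (\<lambda>t. c * d * L t) t
    = evolute I \<gamma> t - ((c * c) * E t) *\<^sub>R B t - ((c * c) * (d * d) * L t) *\<^sub>R N t"
    unfolding involute_def[of I "evolute I \<gamma>"]
    by (simp only: binormal_curve_frame[OF \<sigma> t] sgn_h[OF t] sgn_q[OF t]) (simp add: mult_ac)
  then show "involute I (evolute I \<gamma>) (\<lambda>t. - c * E t) (\<lambda>t. c * d * L t) t = \<gamma> t"
    by (simp add: cc dd evolute_eq)
qed

end

section \<open>Evolutes and involutes are inverse operations\<close>

lemma perfect_domain_interval:
  assumes "is_interval I" "interior I \<noteq> {}"
  shows "perfect_domain I"
proof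
  fix t assume t: "t \<in> I"
  have "I \<noteq> {t}" using assms(2) by auto
  with t have "t islimpt I"
    using connected_imp_perfect is_interval_connected[OF assms(1)] by blast
  then show "at t within I \<noteq> bot" by (simp add: trivial_limit_within)
qed

theorem theorem5p3:
  fixes I :: "real set" and \<gamma> :: "real \<Rightarrow> real^3"
  assumes "is_interval I" and "interior I \<noteq> {}"
    and "nondegenerate I \<gamma>"
    and "\<forall>t\<in>I. torsion I \<gamma> t \<noteq> 0"
  shows
    "(\<forall>lam eta. involute_pair I \<gamma> lam eta \<longrightarrow>
        evolute_exists I (involute I \<gamma> lam eta) \<and>
        (\<forall>t\<in>I. evolute I (involute I \<gamma> lam eta) t = \<gamma> t))
     \<and>
     ((\<forall>t\<in>I. evolute_h I \<gamma> t \<noteq> 0) \<longrightarrow>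
        ((\<forall>t\<in>I. torsion I \<gamma> t > 0) \<and> (\<forall>t\<in>I. evolute_h I \<gamma> t > 0) \<longrightarrow>
           involute_exists I (evolute I \<gamma>) (\<lambda>t. - eta_E I \<gamma> t) (\<lambda>t. lambda_E I \<gamma> t) \<and>
           (\<forall>t\<in>I. involute I (evolute I \<gamma>) (\<lambda>t. - eta_E I \<gamma> t) (\<lambda>t. lambda_E I \<gamma> t) t = \<gamma> t))
        \<and>
        ((\<forall>t\<in>I. torsion I \<gamma> t > 0) \<and> (\<forall>t\<in>I. evolute_h I \<gamma> t < 0) \<longrightarrow>
           involute_exists I (evolute I \<gamma>) (\<lambda>t. eta_E I \<gamma> t) (\<lambda>t. - lambda_E I \<gamma> t) \<and>
           (\<forall>t\<in>I. involute I (evolute I \<gamma>) (\<lambda>t. eta_E I \<gamma> t) (\<lambda>t. - lambda_E I \<gamma> t) t = \<gamma> t))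
        \<and>
        ((\<forall>t\<in>I. torsion I \<gamma> t < 0) \<and> (\<forall>t\<in>I. evolute_h I \<gamma> t > 0) \<longrightarrow>
           involute_exists I (evolute I \<gamma>) (\<lambda>t. - eta_E I \<gamma> t) (\<lambda>t. - lambda_E I \<gamma> t) \<and>
           (\<forall>t\<in>I. involute I (evolute I \<gamma>) (\<lambda>t. - eta_E I \<gamma> t) (\<lambda>t. - lambda_E I \<gamma> t) t = \<gamma> t))
        \<and>
        ((\<forall>t\<in>I. torsion I \<gamma> t < 0) \<and> (\<forall>t\<in>I. evolute_h I \<gamma> t < 0) \<longrightarrow>
           involute_exists I (evolute I \<gamma>) (\<lambda>t. eta_E I \<gamma> t) (\<lambda>t. lambda_E I \<gamma> t) \<and>
           (\<forall>t\<in>I. involute I (evolute I \<gamma>) (\<lambda>t. eta_E I \<gamma> t) (\<lambda>t. lambda_E I \<gamma> t) t = \<gamma> t)))"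
proof -
  interpret perfect_domain I by (rule perfect_domain_interval) fact+
  interpret frenet_curve I \<gamma> by unfold_locales (use assms in auto)
  show ?thesis
    using evolute_involute involute_evolute[of 1 1] involute_evolute[of "-1" 1]
      involute_evolute[of 1 "-1"] involute_evolute[of "-1" "-1"]
    by simp
qed

end
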